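(* (Cut-elimination.) Consider the rule $(cut)$: from $\mathcal{G}/\!/\Gamma\vdash\Delta,A/\!/\mathcal{H}$ and $\mathcal{F}/\!/A^{k_1},\Gamma_1\vdash\Delta_1/\!/\cdots/\!/A^{k_n},\Gamma_n\vdash\Delta_n$ infer $$(\mathcal{G}\oplus\mathcal{F})/\!/\Gamma,\Gamma_1\vdash\Delta,\Delta_1/\!/\big(\mathcal{H}\oplus(\Gamma_2\vdash\Delta_2/\!/\cdots/\!/\Gamma_n\vdash\Delta_n)\big),$$ where $\mathcal{G}$ and $\mathcal{F}$ have the same number of components, $\mathcal{H}$ has $n-1$ components, and $\sum_{i=1}^n k_i\ge 1$. Then $(cut)$ is eliminable in $\mathsf{LNIF}$: every linear nested sequent derivable in $\mathsf{LNIF}$ extended with $(cut)$ is derivable in $\mathsf{LNIF}$.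
   Context: $A^{k}$ denotes $k$ copies of the formula $A$. The splice $\oplus$ of two sequences of components is defined by: $(\Gamma_1\vdash\Delta_1)\oplus(\Gamma_2\vdash\Delta_2)=\Gamma_1,\Gamma_2\vdash\Delta_1,\Delta_2$; $(\Gamma_1\vdash\Delta_1)\oplus(\Gamma_2\vdash\Delta_2/\!/\mathcal{F})=\Gamma_1,\Gamma_2\vdash\Delta_1,\Delta_2/\!/\mathcal{F}$; $(\Gamma_1\vdash\Delta_1/\!/\mathcal{F})\oplus(\Gamma_2\vdash\Delta_2)=\Gamma_1,\Gamma_2\vdash\Delta_1,\Delta_2/\!/\mathcal{F}$; $(\Gamma_1\vdash\Delta_1/\!/\mathcal{F})\oplus(\Gamma_2\vdash\Delta_2/\!/\mathcal{K})=\Gamma_1,\Gamma_2\vdash\Delta_1,\Delta_2/\!/(\mathcal{F}\oplus\mathcal{K})$ (the splice of two empty sequences is empty). Formulae are first-order over $\bot,\land,\lor,\supset,\forall,\exists$; in sequents bound variables $x,y,\dots$ are distinct from parameters $a,b,\dots$, which occupy all free positions; $A[a/x]$ replaces free occurrences of $x$ by $a$; $p(\vec a)$ is an atomic formula with parameters $\vec a$. A linear nested sequent is $\Gamma_1\vdash\Delta_1 /\!/ \cdots /\!/ \Gamma_n\vdash\Delta_n$ ($n\ge1$), each $\Gamma_i,\Delta_i$ a finite, possibly empty, multiset of formulae (a component). In rule schemas, $\mathcal{G},\mathcal{H},\mathcal{F}$ denote possibly empty sequences of components. $\mathsf{LNIF}$ has the rules (from premise(s) infer conclusion): Initial: $(id_1)$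 $\mathcal{G}/\!/\Gamma,p(\vec a)\vdash p(\vec a),\Delta/\!/\mathcal{H}$; $(id_2)$ $\mathcal{G}/\!/\Gamma_1,p(\vec a)\vdash\Delta_1/\!/\mathcal{H}/\!/\Gamma_2\vdash p(\vec a),\Delta_2/\!/\mathcal{F}$; $(\bot_l)$ $\mathcal{G}/\!/\Gamma,\bot\vdash\Delta/\!/\mathcal{H}$. $(\land_l)$: from $\mathcal{G}/\!/\Gamma,A,B\vdash\Delta/\!/\mathcal{H}$ infer $\mathcal{G}/\!/\Gamma,A\land B\vdash\Delta/\!/\mathcal{H}$. $(\lor_r)$: from $\mathcal{G}/\!/\Gamma\vdash\Delta,A,B/\!/\mathcal{H}$ infer $\mathcal{G}/\!/\Gamma\vdash\Delta,A\lor B/\!/\mathcal{H}$. $(\land_r)$: from $\mathcal{G}/\!/\Gamma\vdash\Delta,A/\!/\mathcal{H}$ and $\mathcal{G}/\!/\Gamma\vdash\Delta,B/\!/\mathcal{H}$ infer $\mathcal{G}/\!/\Gamma\vdash\Delta,A\land B/\!/\mathcal{H}$. $(\lor_l)$: from $\mathcal{G}/\!/\Gamma,A\vdash\Delta/\!/\mathcal{H}$ and $\mathcal{G}/\!/\Gamma,B\vdash\Delta/\!/\mathcal{H}$ infer $\mathcal{G}/\!/\Gamma,A\lor B\vdash\Delta/\!/\mathcal{H}$. $(\supset_{r1})$: from $\mathcal{G}/\!/\Gamma\vdash\Delta/\!/A\vdash B$ infer $\mathcal{G}/\!/\Gamma\vdash\Delta,A\supset B$. $(\supset_l)$: from $\mathcal{G}/\!/\Gamma,B\vdash\Delta/\!/\mathcal{H}$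 and $\mathcal{G}/\!/\Gamma,A\supset B\vdash A,\Delta/\!/\mathcal{H}$ infer $\mathcal{G}/\!/\Gamma,A\supset B\vdash\Delta/\!/\mathcal{H}$. $(lift)$: from $\mathcal{G}/\!/\Gamma_1,A\vdash\Delta_1/\!/\Gamma_2,A\vdash\Delta_2/\!/\mathcal{H}$ infer $\mathcal{G}/\!/\Gamma_1,A\vdash\Delta_1/\!/\Gamma_2\vdash\Delta_2/\!/\mathcal{H}$. $(\forall_l)$: from $\mathcal{G}/\!/\Gamma,A[a/x],\forall xA\vdash\Delta/\!/\mathcal{H}$ infer $\mathcal{G}/\!/\Gamma,\forall xA\vdash\Delta/\!/\mathcal{H}$ ($a$ any parameter). $(\forall_{r1})$: from $\mathcal{G}/\!/\Gamma\vdash\Delta/\!/\ \vdash A[a/x]$ infer $\mathcal{G}/\!/\Gamma\vdash\Delta,\forall xA$. $(\exists_l)$: from $\mathcal{G}/\!/\Gamma,A[a/x]\vdash\Delta/\!/\mathcal{H}$ infer $\mathcal{G}/\!/\Gamma,\exists xA\vdash\Delta/\!/\mathcal{H}$. $(\exists_r)$: from $\mathcal{G}/\!/\Gamma\vdash A[a/x],\exists xA,\Delta/\!/\mathcal{H}$ infer $\mathcal{G}/\!/\Gamma\vdash\exists xA,\Delta/\!/\mathcal{H}$ ($a$ any parameter). $(\supset_{r2})$: from $\mathcal{G}/\!/\Gamma_1\vdash\Delta_1/\!/A\vdash B/\!/\Gamma_2\vdash\Delta_2/\!/\mathcal{H}$ and $\mathcal{G}/\!/\Gamma_1\vdash\Delta_1/\!/\Gamma_2\vdash\Delta_2,A\supset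 B/\!/\mathcal{H}$ infer $\mathcal{G}/\!/\Gamma_1\vdash\Delta_1,A\supset B/\!/\Gamma_2\vdash\Delta_2/\!/\mathcal{H}$. $(\forall_{r2})$: from $\mathcal{G}/\!/\Gamma_1\vdash\Delta_1/\!/\ \vdash A[a/x]/\!/\Gamma_2\vdash\Delta_2/\!/\mathcal{H}$ and $\mathcal{G}/\!/\Gamma_1\vdash\Delta_1/\!/\Gamma_2\vdash\Delta_2,\forall xA/\!/\mathcal{H}$ infer $\mathcal{G}/\!/\Gamma_1\vdash\Delta_1,\forall xA/\!/\Gamma_2\vdash\Delta_2/\!/\mathcal{H}$. In $(\forall_{r1}),(\exists_l),(\forall_{r2})$, $a$ is an eigenvariable (does not occur in the conclusion). *)

theory Defs
  imports Main "HOL-Library.Multiset"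
begin

text \<open>
  First-order formulae over predicate symbols of type \<open>'p\<close>; a symbol applied to lists of different
  lengths counts as different predicates, so every arity is available. There are no function
  symbols. Variables (the only things that are bound) and parameters (never bound) are distinct
  sorts, each countably infinite. Formulae are not identified up to renaming of bound variables.
\<close>

datatype tm = Var nat | Par nat

datatype 'p fm =
    Atom 'p "tm list"
  | Bot
  | Conj "'p fm" "'p fm"
  | Disj "'p fm" "'p fm"
  | Imp "'p fm" "'p fm"
  | Forall nat "'p fm"
  | Exists nat "'p fm"

primrec fvars_tm :: "tm \<Rightarrow> nat set" where
  "fvars_tm (Var x) = {x}"
| "fvars_tm (Par a) = {}"

primrec params_tm :: "tm \<Rightarrow> nat set" where
  "params_tm (Var x) = {}"
| "params_tm (Par a) = {a}"

primrec subst_tm :: "nat \<Rightarrow> nat \<Rightarrow> tm \<Rightarrow> tm" where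
  "subst_tm a x (Var y) = (if y = x then Par a else Var y)"
| "subst_tm a x (Par b) = Par b"

primrec fvars :: "'p fm \<Rightarrow> nat set" where
  "fvars (Atom p ts) = (\<Union>t\<in>set ts. fvars_tm t)"
| "fvars Bot = {}"
| "fvars (Conj A B) = fvars A \<union> fvars B"
| "fvars (Disj A B) = fvars A \<union> fvars B"
| "fvars (Imp A B) = fvars A \<union> fvars B"
| "fvars (Forall x A) = fvars A - {x}"
| "fvars (Exists x A) = fvars A - {x}"

primrec params :: "'p fm \<Rightarrow> nat set" where
  "params (Atom p ts) = (\<Union>t\<in>set ts. params_tm t)"
| "params Bot = {}"
| "params (Conj A B) = params A \<union> params B"
| "params (Disj A B) = params A \<union> params B"
| "params (Imp A B) = params A \<union> params B"
| "params (Forall x A) = params A"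
| "params (Exists x A) = params A"

text \<open>
  \<open>subst a x A\<close> is $A[a/x]$. Parameters are never bound, so capture cannot arise.
\<close>

primrec subst :: "nat \<Rightarrow> nat \<Rightarrow> 'p fm \<Rightarrow> 'p fm" where
  "subst a x (Atom p ts) = Atom p (map (subst_tm a x) ts)"
| "subst a x Bot = Bot"
| "subst a x (Conj A B) = Conj (subst a x A) (subst a x B)"
| "subst a x (Disj A B) = Disj (subst a x A) (subst a x B)"
| "subst a x (Imp A B) = Imp (subst a x A) (subst a x B)"
| "subst a x (Forall y A) = Forall y (if y = x then A else subst a x A)"
| "subst a x (Exists y A) = Exists y (if y = x then A else subst a x A)"

type_synonym 'p component = "'p fm multiset \<times> 'p fm multiset"

text \<open>
  Sequences of components, possibly empty. The linear nested sequents are those that satisfy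
  \<open>is_lns\<close>: nonempty, with parameters in all free positions, i.e. without free variables.
\<close>

type_synonym 'p comps = "'p component list"

definition is_lns :: "'p comps \<Rightarrow> bool" where
  "is_lns S \<longleftrightarrow> S \<noteq> [] \<and> (\<forall>(\<Gamma>, \<Delta>)\<in>set S. \<forall>A\<in>#\<Gamma> + \<Delta>. fvars A = {})"

definition params_comps :: "'p comps \<Rightarrow> nat set" where
  "params_comps S = (\<Union>(\<Gamma>, \<Delta>)\<in>set S. \<Union>A\<in>set_mset (\<Gamma> + \<Delta>). params A)"

text \<open>
  The equations with exactly one empty argument are a convention that makes the function total;
  together with the last equation they yield the usual clauses for sequences of unequal length.
\<close>

fun splice_comps :: "'p comps \<Rightarrow> 'p comps \<Rightarrow> 'p comps"  (infixl "\<oplus>" 66) where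
  "[] \<oplus> T = T"
| "S \<oplus> [] = S"
| "((\<Gamma>\<^sub>1, \<Delta>\<^sub>1) # S) \<oplus> ((\<Gamma>\<^sub>2, \<Delta>\<^sub>2) # T) = (\<Gamma>\<^sub>1 + \<Gamma>\<^sub>2, \<Delta>\<^sub>1 + \<Delta>\<^sub>2) # (S \<oplus> T)"

text \<open>
  A rule is the set of its instances, given as a relation between the list of premises and the
  conclusion.
\<close>

type_synonym 'p rule = "'p comps list \<Rightarrow> 'p comps \<Rightarrow> bool"

inductive LNIF :: "'p rule" where
  id1: "LNIF []
    (G @ [(add_mset (Atom p (map Par as)) \<Gamma>, add_mset (Atom p (map Par as)) \<Delta>)] @ H)"
| id2: "LNIF []
    (G @ [(add_mset (Atom p (map Par as)) \<Gamma>\<^sub>1, \<Delta>\<^sub>1)] @ H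
       @ [(\<Gamma>\<^sub>2, add_mset (Atom p (map Par as)) \<Delta>\<^sub>2)] @ F)"
| bot_l: "LNIF [] (G @ [(add_mset Bot \<Gamma>, \<Delta>)] @ H)"
| conj_l: "LNIF
    [G @ [(add_mset A (add_mset B \<Gamma>), \<Delta>)] @ H]
    (G @ [(add_mset (Conj A B) \<Gamma>, \<Delta>)] @ H)"
| disj_r: "LNIF
    [G @ [(\<Gamma>, add_mset A (add_mset B \<Delta>))] @ H]
    (G @ [(\<Gamma>, add_mset (Disj A B) \<Delta>)] @ H)"
| conj_r: "LNIF
    [G @ [(\<Gamma>, add_mset A \<Delta>)] @ H,
     G @ [(\<Gamma>, add_mset B \<Delta>)] @ H]
    (G @ [(\<Gamma>, add_mset (Conj A B) \<Delta>)] @ H)"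
| disj_l: "LNIF
    [G @ [(add_mset A \<Gamma>, \<Delta>)] @ H,
     G @ [(add_mset B \<Gamma>, \<Delta>)] @ H]
    (G @ [(add_mset (Disj A B) \<Gamma>, \<Delta>)] @ H)"
| imp_r1: "LNIF
    [G @ [(\<Gamma>, \<Delta>), ({#A#}, {#B#})]]
    (G @ [(\<Gamma>, add_mset (Imp A B) \<Delta>)])"
| imp_l: "LNIF
    [G @ [(add_mset B \<Gamma>, \<Delta>)] @ H,
     G @ [(add_mset (Imp A B) \<Gamma>, add_mset A \<Delta>)] @ H]
    (G @ [(add_mset (Imp A B) \<Gamma>, \<Delta>)] @ H)"
| lift: "LNIF
    [G @ [(add_mset A \<Gamma>\<^sub>1, \<Delta>\<^sub>1), (add_mset A \<Gamma>\<^sub>2, \<Delta>\<^sub>2)] @ H]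
    (G @ [(add_mset A \<Gamma>\<^sub>1, \<Delta>\<^sub>1), (\<Gamma>\<^sub>2, \<Delta>\<^sub>2)] @ H)"
| forall_l: "LNIF
    [G @ [(add_mset (subst a x A) (add_mset (Forall x A) \<Gamma>), \<Delta>)] @ H]
    (G @ [(add_mset (Forall x A) \<Gamma>, \<Delta>)] @ H)"
| forall_r1: "a \<notin> params_comps (G @ [(\<Gamma>, add_mset (Forall x A) \<Delta>)]) \<Longrightarrow> LNIF
    [G @ [(\<Gamma>, \<Delta>), ({#}, {#subst a x A#})]]
    (G @ [(\<Gamma>, add_mset (Forall x A) \<Delta>)])"
| exists_l: "a \<notin> params_comps (G @ [(add_mset (Exists x A) \<Gamma>, \<Delta>)] @ H) \<Longrightarrow> LNIF
    [G @ [(add_mset (subst a x A) \<Gamma>, \<Delta>)] @ H]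
    (G @ [(add_mset (Exists x A) \<Gamma>, \<Delta>)] @ H)"
| exists_r: "LNIF
    [G @ [(\<Gamma>, add_mset (subst a x A) (add_mset (Exists x A) \<Delta>))] @ H]
    (G @ [(\<Gamma>, add_mset (Exists x A) \<Delta>)] @ H)"
| imp_r2: "LNIF
    [G @ [(\<Gamma>\<^sub>1, \<Delta>\<^sub>1), ({#A#}, {#B#}), (\<Gamma>\<^sub>2, \<Delta>\<^sub>2)] @ H,
     G @ [(\<Gamma>\<^sub>1, \<Delta>\<^sub>1), (\<Gamma>\<^sub>2, add_mset (Imp A B) \<Delta>\<^sub>2)] @ H]
    (G @ [(\<Gamma>\<^sub>1, add_mset (Imp A B) \<Delta>\<^sub>1), (\<Gamma>\<^sub>2, \<Delta>\<^sub>2)] @ H)"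
| forall_r2: "a \<notin> params_comps (G @ [(\<Gamma>\<^sub>1, add_mset (Forall x A) \<Delta>\<^sub>1), (\<Gamma>\<^sub>2, \<Delta>\<^sub>2)] @ H) \<Longrightarrow> LNIF
    [G @ [(\<Gamma>\<^sub>1, \<Delta>\<^sub>1), ({#}, {#subst a x A#}), (\<Gamma>\<^sub>2, \<Delta>\<^sub>2)] @ H,
     G @ [(\<Gamma>\<^sub>1, \<Delta>\<^sub>1), (\<Gamma>\<^sub>2, add_mset (Forall x A) \<Delta>\<^sub>2)] @ H]
    (G @ [(\<Gamma>\<^sub>1, add_mset (Forall x A) \<Delta>\<^sub>1), (\<Gamma>\<^sub>2, \<Delta>\<^sub>2)] @ H)"

text \<open>
  In \<open>cut\<close> the numbers $k_1$ and $k_2,\dots,k_n$ are \<open>k\<close> and the entries of \<open>ks\<close>, and \<open>K\<close> is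
  the sequence of the components $\Gamma_2\vdash\Delta_2$, \dots, $\Gamma_n\vdash\Delta_n$.
\<close>

definition add_left :: "'p fm \<Rightarrow> nat \<Rightarrow> 'p component \<Rightarrow> 'p component" where
  "add_left A k = (\<lambda>(\<Gamma>, \<Delta>). (replicate_mset k A + \<Gamma>, \<Delta>))"

inductive cut :: "'p rule" where
  "\<lbrakk> length G = length F; length H = length K; length ks = length K; k + sum_list ks \<ge> 1 \<rbrakk>
   \<Longrightarrow> cut
    [G @ [(\<Gamma>, add_mset A \<Delta>)] @ H,
     F @ [add_left A k (\<Gamma>\<^sub>1, \<Delta>\<^sub>1)] @ map2 (add_left A) ks K]
    ((G \<oplus> F) @ [(\<Gamma> + \<Gamma>\<^sub>1, \<Delta> + \<Delta>\<^sub>1)] @ (H \<oplus> K))"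

text \<open>
  Rule schemas are stated for arbitrary sequences; \<open>is_lns\<close> below restricts derivations to those
  in which every node is a linear nested sequent.
\<close>

inductive derivable :: "'p rule \<Rightarrow> 'p comps \<Rightarrow> bool" for R where
  "\<lbrakk> R Ps S; is_lns S; \<forall>P\<in>set Ps. derivable R P \<rbrakk> \<Longrightarrow> derivable R S"

end

theory Submission
  imports Defs Complex_Main "HOL-Library.Countable"
begin

text \<open>
  The argument is semantic. A linear nested sequent is refuted by a weakly increasing chain of
  worlds, one for each component, in a linearly ordered Kripke model with constant domain; all
  rules of \<open>LNIF\<close> and the cut rule preserve irrefutability. For the cut rule, look at the world of
  the active component: either the cut formula fails there, and the left premise is refuted, or it
  holds there and hence at all later worlds, and the right premise is refuted.

  Conversely, an underivable sequent is refuted. Label its components by rational numbers and apply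
  the rules backwards in a fair way, keeping the sequent underivable. An implication or universal
  quantification on the right is shifted to later components by \<open>imp_r2\<close> and \<open>forall_r2\<close> until a
  witnessing component can be inserted, which density makes room for. The labels of all stages
  are the worlds of the countermodel, and the parameters are its domain.
\<close>

section \<open>Linear Kripke models with constant domains\<close>

primrec val_tm :: "(nat \<Rightarrow> 'd) \<Rightarrow> (nat \<Rightarrow> 'd) \<Rightarrow> tm \<Rightarrow> 'd" where
  "val_tm \<rho> e (Var x) = e x"
| "val_tm \<rho> e (Par a) = \<rho> a"

text \<open>\<open>\<rho>\<close> interprets the parameters and \<open>e\<close> the variables. The
  \<open>Forall\<close> clause looks at \<open>w\<close> alone: the domain is constant, so for
  monotone \<open>V\<close> looking at later worlds as well would give the same notion, by
  \<open>sat_mono\<close>.\<close>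

primrec sat :: "'w::linorder set \<Rightarrow> ('w \<Rightarrow> 'p \<Rightarrow> 'd list \<Rightarrow> bool) \<Rightarrow> (nat \<Rightarrow> 'd) \<Rightarrow> (nat \<Rightarrow> 'd) \<Rightarrow> 'w \<Rightarrow> 'p fm \<Rightarrow> bool"
  where
  "sat W V \<rho> e w (Atom p ts) = V w p (map (val_tm \<rho> e) ts)"
| "sat W V \<rho> e w Bot = False"
| "sat W V \<rho> e w (Conj A B) = (sat W V \<rho> e w A \<and> sat W V \<rho> e w B)"
| "sat W V \<rho> e w (Disj A B) = (sat W V \<rho> e w A \<or> sat W V \<rho> e w B)"
| "sat W V \<rho> e w (Imp A B) = (\<forall>v\<in>W. w \<le> v \<longrightarrow> sat W V \<rho> e v A \<longrightarrow> sat W V \<rho> e v B)"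
| "sat W V \<rho> e w (Forall x A) = (\<forall>d. sat W V \<rho> (e(x := d)) w A)"
| "sat W V \<rho> e w (Exists x A) = (\<exists>d. sat W V \<rho> (e(x := d)) w A)"

lemma sat_mono:
  assumes "mono V" "w \<le> v" "sat W V \<rho> e w A"
  shows "sat W V \<rho> e v A"
  using assms(2,3)
proof (induction A arbitrary: e w v)
  case (Atom p ts)
  then show ?case using monoD[OF assms(1) Atom(1)] by (auto simp: le_fun_def)
next
  case (Imp A B)
  then show ?case by (meson order_trans sat.simps(5))
qed (simp_all, blast+)

lemma val_subst_tm: "val_tm \<rho> e (subst_tm a x t) = val_tm \<rho> (e(x := \<rho> a)) t"
  by (cases t) auto

lemma sat_subst: "sat W V \<rho> e w (subst a x A) = sat W V \<rho> (e(x := \<rho> a)) w A"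
  by (induction A arbitrary: e w) (auto simp: val_subst_tm comp_def fun_upd_twist)

lemma sat_fresh: "a \<notin> params A \<Longrightarrow> sat W V (\<rho>(a := d)) e w A = sat W V \<rho> e w A"
proof (induction A arbitrary: e w)
  case (Atom p ts)
  have "map (val_tm (\<rho>(a := d)) e) ts = map (val_tm \<rho> e) ts"
  proof (rule map_cong[OF refl])
    fix t assume "t \<in> set ts"
    then have "a \<notin> params_tm t" using Atom by auto
    then show "val_tm (\<rho>(a := d)) e t = val_tm \<rho> e t" by (cases t) auto
  qed
  then show ?case by (simp only: sat.simps)
qed auto

definition refutes ::
  "'w::linorder set \<Rightarrow> ('w \<Rightarrow> 'p \<Rightarrow> 'd list \<Rightarrow> bool) \<Rightarrow> (nat \<Rightarrow> 'd) \<Rightarrow> (nat \<Rightarrow> 'd) \<Rightarrow> 'w \<Rightarrow> 'p component \<Rightarrow> bool"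
  where "refutes W V \<rho> e w c \<longleftrightarrow>
    (\<forall>A\<in>#fst c. sat W V \<rho> e w A) \<and> (\<forall>A\<in>#snd c. \<not> sat W V \<rho> e w A)"

text \<open>\<open>\<rho>\<close> is quantified existentially because eigenvariable rules
  reinterpret their parameter on the way from conclusion to premise, while \<open>W\<close>,
  \<open>V\<close> and \<open>e\<close> stay fixed. The order of \<open>ws\<close> is weak, so that
  neighbouring components may share a world.\<close>

definition refutable ::
  "'w::linorder set \<Rightarrow> ('w \<Rightarrow> 'p \<Rightarrow> 'd list \<Rightarrow> bool) \<Rightarrow> (nat \<Rightarrow> 'd) \<Rightarrow> 'p comps \<Rightarrow> bool"
  where "refutable W V e S \<longleftrightarrow>
    (\<exists>ws \<rho>. sorted ws \<and> set ws \<subseteq> W \<and> list_all2 (refutes W V \<rho> e) ws S)"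

section \<open>Soundness of the rules and of cut\<close>

lemma params_comps_simps [simp]:
  "params_comps (S @ T) = params_comps S \<union> params_comps T"
  "params_comps (c # S) = (\<Union>A\<in>set_mset (fst c + snd c). params A) \<union> params_comps S"
  "params_comps [] = {}"
  by (auto simp: params_comps_def)

text \<open>Lets an eigenvariable be reinterpreted as a semantic witness without disturbing the
  conclusion of its rule.\<close>

lemma refutes_fresh:
  assumes "a \<notin> params_comps S" "list_all2 (refutes W V \<rho> e) ws S"
  shows "list_all2 (refutes W V (\<rho>(a := d)) e) ws S"
  using assms(2,1)
  by (induction rule: list_all2_induct) (auto simp: refutes_def sat_fresh)

lemma list_all2_splice:
  assumes "length S = length T"
  shows "list_all2 (refutes W V \<rho> e) ws (S \<oplus> T) \<longleftrightarrow>
    list_all2 (refutes W V \<rho> e) ws S \<and> list_all2 (refutes W V \<rho> e) ws T"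
  using assms
  by (induction S T arbitrary: ws rule: splice_comps.induct)
    (auto simp: list_all2_Cons2 refutes_def)

lemma list_all2_add_left:
  assumes "length ks = length K" "list_all2 (refutes W V \<rho> e) ws K" "\<forall>w\<in>set ws. sat W V \<rho> e w A"
  shows "list_all2 (refutes W V \<rho> e) ws (map2 (add_left A) ks K)"
  using assms
  by (induction ks K arbitrary: ws rule: list_induct2)
    (auto simp: list_all2_Cons2 refutes_def add_left_def)

lemma cut_sound:
  assumes "cut Ps C" "mono V" "refutable W V e C"
  shows "\<exists>P\<in>set Ps. refutable W V e P"
  using assms
proof cases
  case (1 G F H K ks k \<Gamma> A \<Delta> \<Gamma>1 \<Delta>1)
  let ?R = "\<lambda>\<rho>. refutes W V \<rho> e"
  obtain us w vs \<rho> where ws: "sorted (us @ w # vs)" "set (us @ w # vs) \<subseteq> W"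
    and us: "list_all2 (?R \<rho>) us (G \<oplus> F)" and w: "?R \<rho> w (\<Gamma> + \<Gamma>1, \<Delta> + \<Delta>1)"
    and vs: "list_all2 (?R \<rho>) vs (H \<oplus> K)"
    using assms(3) unfolding 1 refutable_def
    by (auto simp: list_all2_append2 list_all2_Cons2)
  show ?thesis
  proof (cases "sat W V \<rho> e w A")
    case True
    then have "\<forall>v\<in>set vs. sat W V \<rho> e v A"
      using ws sat_mono[OF assms(2)] by (auto simp: sorted_append)
    then have "list_all2 (?R \<rho>) (us @ [w] @ vs) (F @ [add_left A k (\<Gamma>1, \<Delta>1)] @ map2 (add_left A) ks K)"
      using us w vs 1 True list_all2_add_left[of ks K W V \<rho> e vs A]
      by (intro list_all2_appendI) (simp_all add: list_all2_splice, auto simp: refutes_def add_left_def)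
    then show ?thesis using ws 1 unfolding refutable_def by fastforce
  next
    case False
    then have "list_all2 (?R \<rho>) (us @ [w] @ vs) (G @ [(\<Gamma>, add_mset A \<Delta>)] @ H)"
      using us w vs 1
      by (intro list_all2_appendI) (auto simp: list_all2_splice refutes_def)
    then show ?thesis using ws 1 unfolding refutable_def by fastforce
  qed
qed

lemma refutable_appI:
  assumes "sorted (us @ zs @ vs)" "set (us @ zs @ vs) \<subseteq> W"
    "list_all2 (refutes W V \<rho> e) us G" "list_all2 (refutes W V \<rho> e) zs Z"
    "list_all2 (refutes W V \<rho> e) vs H"
  shows "refutable W V e (G @ Z @ H)"
  using assms unfolding refutable_def by (blast intro: list_all2_appendI)

lemma refutable_appE:
  assumes "refutable W V e (G @ Z @ H)"
  obtains us zs vs \<rho> where "sorted (us @ zs @ vs)" "set (us @ zs @ vs) \<subseteq> W"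
    "list_all2 (refutes W V \<rho> e) us G" "list_all2 (refutes W V \<rho> e) zs Z"
    "list_all2 (refutes W V \<rho> e) vs H"
  using assms unfolding refutable_def by (auto simp: list_all2_append2)

text \<open>Reduces rules that change a single component to a check at a single world. With
  \<open>C\<close> empty the conclusion is absurd, which is the case of initial sequents.\<close>

lemma refutable_local:
  assumes "refutable W V e (G @ [c] @ H)"
    "\<And>\<rho> w. w \<in> W \<Longrightarrow> refutes W V \<rho> e w c \<Longrightarrow> \<exists>c'\<in>C. refutes W V \<rho> e w c'"
  shows "\<exists>c'\<in>C. refutable W V e (G @ [c'] @ H)"
proof -
  obtain us zs vs \<rho> where *: "sorted (us @ zs @ vs)" "set (us @ zs @ vs) \<subseteq> W"
    "list_all2 (refutes W V \<rho> e) us G" "list_all2 (refutes W V \<rho> e) zs [c]"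
    "list_all2 (refutes W V \<rho> e) vs H"
    using refutable_appE[OF assms(1)] .
  from *(4) obtain w where w: "zs = [w]" "refutes W V \<rho> e w c"
    by (auto simp: list_all2_Cons2)
  with * assms(2)[of w \<rho>] obtain c' where "c' \<in> C" "refutes W V \<rho> e w c'" by auto
  then show ?thesis using refutable_appI[OF *(1,2,3) _ *(5), of "[c']"] w by auto
qed

lemma LNIF_sound:
  assumes "LNIF Ps C" "mono V" "refutable W V e C"
  shows "\<exists>P\<in>set Ps. refutable W V e P"
  using assms(1,3)
proof (induction rule: LNIF.induct)
  case (id1 G p as \<Gamma> \<Delta> H)
  then show ?case
    using refutable_local[of W V e G _ H "{}"] by (fastforce simp: refutes_def)
next
  case (id2 G p as \<Gamma>1 \<Delta>1 H \<Gamma>2 \<Delta>2 F)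
  then obtain us w vs v zs \<rho> where "sorted (us @ [w] @ vs @ [v] @ zs)"
    and "refutes W V \<rho> e w (add_mset (Atom p (map Par as)) \<Gamma>1, \<Delta>1)"
    and "refutes W V \<rho> e v (\<Gamma>2, add_mset (Atom p (map Par as)) \<Delta>2)"
    unfolding refutable_def by (auto simp: list_all2_append2 list_all2_Cons2)
  then show ?case
    using sat_mono[OF assms(2), of w v W \<rho> e "Atom p (map Par as)"]
    by (auto simp: refutes_def sorted_append simp del: sat.simps)
next
  case (bot_l G \<Gamma> \<Delta> H)
  then show ?case
    using refutable_local[of W V e G _ H "{}"] by (fastforce simp: refutes_def)
next
  case (conj_l G A B \<Gamma> \<Delta> H)
  then show ?case
    using refutable_local[of W V e G _ H "{(add_mset A (add_mset B \<Gamma>), \<Delta>)}"]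
    by (fastforce simp: refutes_def)
next
  case (disj_r G \<Gamma> A B \<Delta> H)
  then show ?case
    using refutable_local[of W V e G _ H "{(\<Gamma>, add_mset A (add_mset B \<Delta>))}"]
    by (fastforce simp: refutes_def)
next
  case (conj_r G \<Gamma> A \<Delta> H B)
  then show ?case
    using refutable_local[of W V e G _ H "{(\<Gamma>, add_mset A \<Delta>), (\<Gamma>, add_mset B \<Delta>)}"]
    by (fastforce simp: refutes_def)
next
  case (disj_l G A \<Gamma> \<Delta> H B)
  then show ?case
    using refutable_local[of W V e G _ H "{(add_mset A \<Gamma>, \<Delta>), (add_mset B \<Gamma>, \<Delta>)}"]
    by (fastforce simp: refutes_def)
next
  case (imp_r1 G \<Gamma> \<Delta> A B)
  then obtain us w \<rho> where *: "sorted (us @ [w])" "set (us @ [w]) \<subseteq> W"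
    "list_all2 (refutes W V \<rho> e) us G" "refutes W V \<rho> e w (\<Gamma>, add_mset (Imp A B) \<Delta>)"
    unfolding refutable_def by (auto simp: list_all2_append2 list_all2_Cons2)
  then obtain v where "v \<in> W" "w \<le> v" "sat W V \<rho> e v A" "\<not> sat W V \<rho> e v B"
    by (auto simp: refutes_def)
  then have "refutable W V e (G @ [(\<Gamma>, \<Delta>), ({#A#}, {#B#})] @ [])"
    using * by (intro refutable_appI[of us "[w, v]" "[]" W V \<rho>])
      (auto simp: sorted_append refutes_def)
  then show ?case by simp
next
  case (imp_l G B \<Gamma> \<Delta> H A)
  then show ?case
    using refutable_local[of W V e G _ H "{(add_mset B \<Gamma>, \<Delta>), (add_mset (Imp A B) \<Gamma>, add_mset A \<Delta>)}"]
    by (fastforce simp: refutes_def)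
next
  case (lift G A \<Gamma>1 \<Delta>1 \<Gamma>2 \<Delta>2 H)
  then obtain us w v vs \<rho> where *: "sorted (us @ [w, v] @ vs)" "set (us @ [w, v] @ vs) \<subseteq> W"
    "list_all2 (refutes W V \<rho> e) us G" "list_all2 (refutes W V \<rho> e) vs H"
    "refutes W V \<rho> e w (add_mset A \<Gamma>1, \<Delta>1)" "refutes W V \<rho> e v (\<Gamma>2, \<Delta>2)"
    by (rule refutable_appE) (auto simp: list_all2_Cons2)
  moreover have "sat W V \<rho> e v A"
    using * sat_mono[OF assms(2), of w v W \<rho> e A] by (auto simp: refutes_def sorted_append)
  ultimately have "refutable W V e (G @ [(add_mset A \<Gamma>1, \<Delta>1), (add_mset A \<Gamma>2, \<Delta>2)] @ H)"
    by (intro refutable_appI[of us "[w, v]" vs W V \<rho>]) (auto simp: refutes_def)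
  then show ?case by simp
next
  case (forall_l G a x A \<Gamma> \<Delta> H)
  then show ?case
    using refutable_local[of W V e G _ H "{(add_mset (subst a x A) (add_mset (Forall x A) \<Gamma>), \<Delta>)}"]
    by (fastforce simp: refutes_def sat_subst)
next
  case (forall_r1 a G \<Gamma> x A \<Delta>)
  then obtain us w \<rho> where *: "sorted (us @ [w])" "set (us @ [w]) \<subseteq> W"
    "list_all2 (refutes W V \<rho> e) us G" "refutes W V \<rho> e w (\<Gamma>, add_mset (Forall x A) \<Delta>)"
    unfolding refutable_def by (auto simp: list_all2_append2 list_all2_Cons2)
  then obtain d where d: "\<not> sat W V \<rho> (e(x := d)) w A"
    by (auto simp: refutes_def)
  \<comment> \<open>The eigenvariable now denotes the counterexample \<open>d\<close>. With a
    constant domain \<open>d\<close> already works at \<open>w\<close>, so the new component is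
    placed at a second copy of \<open>w\<close>.\<close>
  let ?\<rho> = "\<rho>(a := d)"
  have "list_all2 (refutes W V ?\<rho> e) (us @ [w]) (G @ [(\<Gamma>, add_mset (Forall x A) \<Delta>)])"
    using * forall_r1 by (intro refutes_fresh list_all2_appendI) auto
  moreover have "refutes W V ?\<rho> e w ({#}, {#subst a x A#})"
    using d forall_r1 by (auto simp: refutes_def sat_subst sat_fresh)
  ultimately have "refutable W V e (G @ [(\<Gamma>, \<Delta>), ({#}, {#subst a x A#})] @ [])"
    using * by (intro refutable_appI[of us "[w, w]" "[]" W V ?\<rho>])
      (auto simp: sorted_append refutes_def list_all2_append list_all2_lengthD)
  then show ?case by simp
next
  case (exists_l a G x A \<Gamma> \<Delta> H)
  then obtain us w vs \<rho> where *: "sorted (us @ [w] @ vs)" "set (us @ [w] @ vs) \<subseteq> W"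
    "list_all2 (refutes W V \<rho> e) us G" "refutes W V \<rho> e w (add_mset (Exists x A) \<Gamma>, \<Delta>)"
    "list_all2 (refutes W V \<rho> e) vs H"
    unfolding refutable_def by (auto simp: list_all2_append2 list_all2_Cons2)
  then obtain d where d: "sat W V \<rho> (e(x := d)) w A"
    by (auto simp: refutes_def)
  let ?\<rho> = "\<rho>(a := d)"
  have "list_all2 (refutes W V ?\<rho> e) (us @ [w] @ vs) (G @ [(add_mset (Exists x A) \<Gamma>, \<Delta>)] @ H)"
    using * exists_l by (intro refutes_fresh list_all2_appendI) auto
  moreover have "sat W V ?\<rho> e w (subst a x A)"
    using d exists_l by (auto simp: sat_subst sat_fresh)
  ultimately have "refutable W V e (G @ [(add_mset (subst a x A) \<Gamma>, \<Delta>)] @ H)"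
    using * by (intro refutable_appI[of us "[w]" vs W V ?\<rho>])
      (auto simp: refutes_def list_all2_append list_all2_lengthD)
  then show ?case by simp
next
  case (exists_r G \<Gamma> a x A \<Delta> H)
  then show ?case
    using refutable_local[of W V e G _ H "{(\<Gamma>, add_mset (subst a x A) (add_mset (Exists x A) \<Delta>))}"]
    by (fastforce simp: refutes_def sat_subst)
next
  case (imp_r2 G \<Gamma>1 \<Delta>1 A B \<Gamma>2 \<Delta>2 H)
  then obtain us w w' vs \<rho> where *: "sorted (us @ [w, w'] @ vs)" "set (us @ [w, w'] @ vs) \<subseteq> W"
    "list_all2 (refutes W V \<rho> e) us G" "list_all2 (refutes W V \<rho> e) vs H"
    "refutes W V \<rho> e w (\<Gamma>1, add_mset (Imp A B) \<Delta>1)" "refutes W V \<rho> e w' (\<Gamma>2, \<Delta>2)"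
    by (rule refutable_appE) (auto simp: list_all2_Cons2)
  then obtain v where v: "v \<in> W" "w \<le> v" "sat W V \<rho> e v A" "\<not> sat W V \<rho> e v B"
    by (auto simp: refutes_def)
  show ?case
  \<comment> \<open>If \<open>v\<close> lies before \<open>w'\<close>, it is the world of the
    inserted component of the first premise. Otherwise \<open>w'\<close> precedes \<open>v\<close>
    by linearity, so the implication fails at \<open>w'\<close> too, as the second premise
    asks.\<close>
  proof (cases "v \<le> w'")
    case True
    then have "refutable W V e (G @ [(\<Gamma>1, \<Delta>1), ({#A#}, {#B#}), (\<Gamma>2, \<Delta>2)] @ H)"
      using * v by (intro refutable_appI[of us "[w, v, w']" vs W V \<rho>])
        (auto simp: sorted_append refutes_def)
    then show ?thesis by simp
  next
    case False
    then have "\<not> sat W V \<rho> e w' (Imp A B)" using v by (auto intro!: bexI[of _ v])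
    then have "refutable W V e (G @ [(\<Gamma>1, \<Delta>1), (\<Gamma>2, add_mset (Imp A B) \<Delta>2)] @ H)"
      using * by (intro refutable_appI[of us "[w, w']" vs W V \<rho>])
        (auto simp: refutes_def simp del: sat.simps)
    then show ?thesis by simp
  qed
next
  case (forall_r2 a G \<Gamma>1 x A \<Delta>1 \<Gamma>2 \<Delta>2 H)
  from forall_r2(2) obtain us w v vs \<rho> where *: "sorted (us @ [w, v] @ vs)" "set (us @ [w, v] @ vs) \<subseteq> W"
    "list_all2 (refutes W V \<rho> e) us G" "list_all2 (refutes W V \<rho> e) vs H"
    "refutes W V \<rho> e w (\<Gamma>1, add_mset (Forall x A) \<Delta>1)" "refutes W V \<rho> e v (\<Gamma>2, \<Delta>2)"
    by (rule refutable_appE) (auto simp: list_all2_Cons2)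
  then obtain d where d: "\<not> sat W V \<rho> (e(x := d)) w A"
    by (auto simp: refutes_def)
  let ?\<rho> = "\<rho>(a := d)"
  have "list_all2 (refutes W V ?\<rho> e) (us @ [w, v] @ vs)
      (G @ [(\<Gamma>1, add_mset (Forall x A) \<Delta>1), (\<Gamma>2, \<Delta>2)] @ H)"
    using * forall_r2 by (intro refutes_fresh list_all2_appendI) auto
  moreover have "refutes W V ?\<rho> e w ({#}, {#subst a x A#})"
    using d forall_r2 by (auto simp: refutes_def sat_subst sat_fresh)
  \<comment> \<open>In contrast to \<open>imp_r2\<close>, the counterexample is found at
    \<open>w\<close> itself, so the first premise is refuted in every case, with \<open>w\<close>
    doubled.\<close>
  ultimately have "refutable W V e (G @ [(\<Gamma>1, \<Delta>1), ({#}, {#subst a x A#}), (\<Gamma>2, \<Delta>2)] @ H)"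
    using * by (intro refutable_appI[of us "[w, w, v]" vs W V ?\<rho>])
      (auto simp: sorted_append refutes_def list_all2_append list_all2_lengthD)
  then show ?case by simp
qed

lemma derivable_sound:
  assumes "derivable (\<lambda>Ps C. LNIF Ps C \<or> cut Ps C) S" "mono V"
  shows "\<not> refutable W V e S"
  using assms(1)
proof induction
  case (1 Ps S)
  show ?case
  proof
    assume "refutable W V e S"
    moreover have "LNIF Ps S \<or> cut Ps S" using 1(1) by simp
    ultimately obtain P where "P \<in> set Ps" "refutable W V e P"
      using LNIF_sound cut_sound assms(2) by meson
    then show False using 1(3) by blast
  qed
qed

section \<open>Underivable sequents\<close>

lemma fvars_subst [simp]: "fvars (subst a x A) = fvars A - {x}"
proof (induction A)
  case (Atom p ts)
  have "fvars_tm (subst_tm a x t) = fvars_tm t - {x}" for t by (cases t) auto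
  then show ?case by auto
qed auto

lemma finite_params: "finite (params A)"
proof (induction A)
  case (Atom p ts)
  have "finite (params_tm t)" for t by (cases t) auto
  then show ?case by auto
qed auto

lemma fresh_param: "\<exists>a. a \<notin> params_comps S"
proof -
  have "finite (params_comps S)"
    by (auto simp: params_comps_def finite_params)
  then show ?thesis using ex_new_if_finite infinite_UNIV_nat by blast
qed

lemma set_fm_subst [simp]: "set_fm (subst a x A) = set_fm A"
  by (induction A) auto

lemma is_lns_iff:
  "is_lns S \<longleftrightarrow> S \<noteq> [] \<and> list_all (\<lambda>c. \<forall>A\<in>#fst c + snd c. fvars A = {}) S"
  by (auto simp: is_lns_def list_all_iff)

lemma LNIF_is_lns: "LNIF Ps C \<Longrightarrow> is_lns C \<Longrightarrow> P \<in> set Ps \<Longrightarrow> is_lns P"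
  by (induction rule: LNIF.induct) (auto simp: is_lns_iff)

text \<open>Read backwards, the rules without cut bring in no new predicate symbol, so the search
  never leaves \<open>Q\<close>.\<close>

lemma LNIF_preds:
  "LNIF Ps C \<Longrightarrow> list_all (\<lambda>c. \<forall>A\<in>#fst c + snd c. set_fm A \<subseteq> Q) C \<Longrightarrow> P \<in> set Ps \<Longrightarrow>
    list_all (\<lambda>c. \<forall>A\<in>#fst c + snd c. set_fm A \<subseteq> Q) P"
  by (induction rule: LNIF.induct) (simp_all, (elim disjE; simp)+)

text \<open>
  The predicate symbols are confined to \<open>Q\<close>, since only formulae over countably many symbols can
  be enumerated.
\<close>

definition underivable :: "'p set \<Rightarrow> 'p comps \<Rightarrow> bool" where
  "underivable Q S \<longleftrightarrow> is_lns S \<and> list_all (\<lambda>c. \<forall>A\<in>#fst c + snd c. set_fm A \<subseteq> Q) S \<and>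
    \<not> derivable LNIF S"

text \<open>If all premises were derivable, the rule would derive the conclusion. This drives the
  whole backward search.\<close>

lemma underivable_premise: "LNIF Ps C \<Longrightarrow> underivable Q C \<Longrightarrow> \<exists>P\<in>set Ps. underivable Q P"
  unfolding underivable_def using LNIF_is_lns LNIF_preds[of Ps C Q] derivable.intros[of LNIF Ps C] by blast

text \<open>The implication walks to the right along \<open>H\<close>. At each component
  \<open>imp_r2\<close> either yields the insertion right there or passes the implication on; at the
  last component \<open>imp_r1\<close> forces the insertion.\<close>

lemma underivable_imp_r:
  assumes "underivable Q (G @ [(\<Gamma>, add_mset (Imp A B) \<Delta>)] @ H)"
  shows "\<exists>H1 H2. H = H1 @ H2 \<and> underivable Q (G @ [(\<Gamma>, \<Delta>)] @ H1 @ [({#A#}, {#B#})] @ H2)"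
  using assms
proof (induction H arbitrary: G \<Gamma> \<Delta>)
  case Nil
  then show ?case using underivable_premise[OF imp_r1[of G \<Gamma> \<Delta> A B]] by auto
next
  case (Cons c H)
  obtain \<Gamma>2 \<Delta>2 where c: "c = (\<Gamma>2, \<Delta>2)" by (cases c)
  consider "underivable Q (G @ [(\<Gamma>, \<Delta>), ({#A#}, {#B#}), (\<Gamma>2, \<Delta>2)] @ H)"
    | "underivable Q ((G @ [(\<Gamma>, \<Delta>)]) @ [(\<Gamma>2, add_mset (Imp A B) \<Delta>2)] @ H)"
    using underivable_premise[OF imp_r2[of G \<Gamma> \<Delta> A B \<Gamma>2 \<Delta>2 H]] Cons.prems c by auto
  then show ?case
  proof cases
    case 1
    then show ?thesis using c by (intro exI[of _ "[]"] exI[of _ "c # H"]) simp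
  next
    case 2
    from Cons.IH[OF this] obtain H1 H2 where "H = H1 @ H2"
      "underivable Q ((G @ [(\<Gamma>, \<Delta>)]) @ [(\<Gamma>2, \<Delta>2)] @ H1 @ [({#A#}, {#B#})] @ H2)" by blast
    then show ?thesis using c by (intro exI[of _ "c # H1"] exI[of _ H2]) simp
  qed
qed

text \<open>The same walk with \<open>forall_r2\<close> and \<open>forall_r1\<close>. A fresh
  eigenvariable is chosen at each component, so \<open>a\<close> depends on where the walk
  stops.\<close>

lemma underivable_forall_r:
  assumes "underivable Q (G @ [(\<Gamma>, add_mset (Forall x A) \<Delta>)] @ H)"
  shows "\<exists>a H1 H2. H = H1 @ H2 \<and> underivable Q (G @ [(\<Gamma>, \<Delta>)] @ H1 @ [({#}, {#subst a x A#})] @ H2)"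
  using assms
proof (induction H arbitrary: G \<Gamma> \<Delta>)
  case Nil
  obtain a where "a \<notin> params_comps (G @ [(\<Gamma>, add_mset (Forall x A) \<Delta>)])" using fresh_param by blast
  then show ?case using Nil underivable_premise[OF forall_r1[of a G \<Gamma> x A \<Delta>]] by fastforce
next
  case (Cons c H)
  obtain \<Gamma>2 \<Delta>2 where c: "c = (\<Gamma>2, \<Delta>2)" by (cases c)
  obtain a where "a \<notin> params_comps (G @ [(\<Gamma>, add_mset (Forall x A) \<Delta>), (\<Gamma>2, \<Delta>2)] @ H)"
    using fresh_param by blast
  then consider "underivable Q (G @ [(\<Gamma>, \<Delta>), ({#}, {#subst a x A#}), (\<Gamma>2, \<Delta>2)] @ H)"
    | "underivable Q ((G @ [(\<Gamma>, \<Delta>)]) @ [(\<Gamma>2, add_mset (Forall x A) \<Delta>2)] @ H)"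
    using underivable_premise[OF forall_r2[of a G \<Gamma> x A \<Delta> \<Gamma>2 \<Delta>2 H]] Cons.prems c by auto
  then show ?case
  proof cases
    case 1
    then show ?thesis using c by (intro exI[of _ a] exI[of _ "[]"] exI[of _ "c # H"]) simp
  next
    case 2
    from Cons.IH[OF this] obtain a H1 H2 where "H = H1 @ H2"
      "underivable Q ((G @ [(\<Gamma>, \<Delta>)]) @ [(\<Gamma>2, \<Delta>2)] @ H1 @ [({#}, {#subst a x A#})] @ H2)" by blast
    then show ?thesis using c by (intro exI[of _ a] exI[of _ "c # H1"] exI[of _ H2]) simp
  qed
qed

text \<open>Iterating \<open>lift\<close> backwards: each component that has received
  \<open>A\<close> hands it to the next.\<close>

lemma underivable_lift:
  assumes "underivable Q (G @ [(add_mset A \<Gamma>, \<Delta>)] @ H)"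
  shows "underivable Q (G @ [(add_mset A \<Gamma>, \<Delta>)] @ map (apfst (add_mset A)) H)"
  using assms
proof (induction H arbitrary: G \<Gamma> \<Delta>)
  case (Cons c H)
  obtain \<Gamma>2 \<Delta>2 where c: "c = (\<Gamma>2, \<Delta>2)" by (cases c)
  have "underivable Q ((G @ [(add_mset A \<Gamma>, \<Delta>)]) @ [(add_mset A \<Gamma>2, \<Delta>2)] @ H)"
    using underivable_premise[OF lift[of G A \<Gamma> \<Delta> \<Gamma>2 \<Delta>2 H]] Cons.prems c by auto
  from Cons.IH[OF this] show ?case using c by simp
qed simp

section \<open>Saturation\<close>

text \<open>
  A state is a finite set of labels, listed in increasing order, with a component for each. In
  \<open>occurs\<close> and its companions the Boolean is \<open>True\<close> for the left-hand side of a component.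
\<close>

type_synonym 'p state = "rat list \<times> (rat \<Rightarrow> 'p component)"

definition occurs :: "bool \<Rightarrow> 'p state \<Rightarrow> rat \<Rightarrow> 'p fm \<Rightarrow> bool" where
  "occurs l s q A \<longleftrightarrow> q \<in> set (fst s) \<and> A \<in># (if l then fst (snd s q) else snd (snd s q))"

text \<open>
  \<open>decomposed\<close> is the condition under which a formula may disappear from its component. For an
  implication on the left it is stronger than the matching part of \<open>fulfilled\<close>: if only the
  antecedent was put on the right, the implication must stay, to be lifted to labels that are
  inserted later.
\<close>

fun decomposed :: "bool \<Rightarrow> 'p state \<Rightarrow> rat \<Rightarrow> 'p fm \<Rightarrow> bool" where
  "decomposed True s q (Conj A B) = (occurs True s q A \<and> occurs True s q B)"
| "decomposed True s q (Disj A B) = (occurs True s q A \<or> occurs True s q B)"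
| "decomposed True s q (Imp A B) = occurs True s q B"
| "decomposed True s q (Exists x A) = (\<exists>a. occurs True s q (subst a x A))"
| "decomposed False s q (Conj A B) = (occurs False s q A \<or> occurs False s q B)"
| "decomposed False s q (Disj A B) = (occurs False s q A \<and> occurs False s q B)"
| "decomposed False s q (Imp A B) = (\<exists>r>q. occurs True s r A \<and> occurs False s r B)"
| "decomposed False s q (Forall x A) = (\<exists>r>q. \<exists>a. occurs False s r (subst a x A))"
| "decomposed _ _ _ _ = False"

text \<open>The parameter \<open>a\<close> is the instance demanded of a \<open>Forall\<close> on
  the left or an \<open>Exists\<close> on the right; such formulae stay and are served again for
  every \<open>a\<close>. The last equation catches the formulae that are served once and for
  all.\<close>

fun fulfilled :: "bool \<Rightarrow> nat \<Rightarrow> 'p state \<Rightarrow> rat \<Rightarrow> 'p fm \<Rightarrow> bool" where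
  "fulfilled True a s q (Imp A B) = ((occurs True s q B \<or> occurs False s q A) \<and>
    (\<forall>r\<in>set (fst s). q < r \<longrightarrow> occurs True s r (Imp A B)))"
| "fulfilled True a s q (Forall x A) = occurs True s q (subst a x A)"
| "fulfilled False a s q (Exists x A) = occurs False s q (subst a x A)"
| "fulfilled l a s q (Atom p ts) = True"
| "fulfilled l a s q Bot = True"
| "fulfilled l a s q A = decomposed l s q A"

text \<open>A formula may vanish in a step only if that same step leaves it decomposed.\<close>

definition extends :: "'p state \<Rightarrow> 'p state \<Rightarrow> bool" where
  "extends s s' \<longleftrightarrow> set (fst s) \<subseteq> set (fst s') \<and>
    (\<forall>l q A. occurs l s q A \<longrightarrow> occurs l s' q A \<or> decomposed l s' q A)"

definition consistent :: "'p set \<Rightarrow> 'p state \<Rightarrow> bool" where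
  "consistent Q s \<longleftrightarrow> sorted_wrt (<) (fst s) \<and> underivable Q (map (snd s) (fst s))"

text \<open>Labels are distinct, so changing \<open>M\<close> at \<open>q\<close> changes exactly
  one component, as a local rule does.\<close>

lemma consistent_update:
  assumes "consistent Q (ws, M)" "q \<in> set ws"
    and rule: "\<And>G H. underivable Q (G @ [M q] @ H) \<Longrightarrow> \<exists>c\<in>C. underivable Q (G @ [c] @ H)"
  shows "\<exists>c\<in>C. consistent Q (ws, M(q := c))"
proof -
  obtain us vs where ws: "ws = us @ q # vs" using assms(2) by (meson split_list)
  then have "q \<notin> set us" "q \<notin> set vs"
    using assms(1) by (auto simp: consistent_def sorted_wrt_append)
  then have "map (M(q := c)) ws = map M us @ [c] @ map M vs" for c using ws by simp
  moreover obtain c where "c \<in> C" "underivable Q (map M us @ [c] @ map M vs)"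
    using rule[of "map M us" "map M vs"] assms(1) ws by (auto simp: consistent_def)
  ultimately show ?thesis using assms(1) by (auto simp: consistent_def)
qed

lemma rat_between:
  fixes us vs :: "rat list"
  assumes "\<forall>x\<in>set us. \<forall>y\<in>set vs. x < y"
  shows "\<exists>r. (\<forall>x\<in>set us. x < r) \<and> (\<forall>y\<in>set vs. r < y)"
proof -
  have "\<exists>u. (\<forall>x\<in>set us. x \<le> u) \<and> (\<forall>y\<in>set vs. u < y)"
  proof (cases "us = []")
    case True
    \<comment> \<open>Inserting \<open>0\<close> keeps \<open>Min\<close> meaningful when
      \<open>vs\<close> is empty as well.\<close>
    have "Min (insert 0 (set vs)) - 1 < y" if "y \<in> set vs" for y
    proof -
      have "Min (insert 0 (set vs)) \<le> y" using that by (intro Min_le) auto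
      then show ?thesis by linarith
    qed
    then show ?thesis using True by auto
  next
    case False
    then show ?thesis using assms by (intro exI[of _ "Max (set us)"]) simp
  qed
  then obtain u where u: "\<forall>x\<in>set us. x \<le> u" "\<forall>y\<in>set vs. u < y" by blast
  have "\<exists>v>u. \<forall>y\<in>set vs. v \<le> y"
  proof (cases "vs = []")
    case True
    then show ?thesis by (intro exI[of _ "u + 1"]) simp
  next
    case False
    then show ?thesis using u by (intro exI[of _ "Min (set vs)"]) simp
  qed
  then obtain v where "u < v" "\<forall>y\<in>set vs. v \<le> y" by blast
  moreover obtain r where "u < r" "r < v" using dense \<open>u < v\<close> by blast
  ultimately show ?thesis using u by (meson le_less_trans less_le_trans)
qed

text \<open>Covers the rules that insert a component \<open>d\<close> somewhere to the right of
  \<open>q\<close>: the split of the later components is pulled back to a split of their labels, and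
  \<open>r\<close> is a rational in the gap.\<close>

lemma consistent_insert:
  assumes "consistent Q (ws, M)" "q \<in> set ws"
    and rule: "\<And>G H. underivable Q (G @ [M q] @ H) \<Longrightarrow>
      \<exists>d\<in>D. \<exists>H1 H2. H = H1 @ H2 \<and> underivable Q (G @ [c] @ H1 @ [d] @ H2)"
  shows "\<exists>d\<in>D. \<exists>ws' r. set ws' = insert r (set ws) \<and> r \<notin> set ws \<and> q < r \<and>
    consistent Q (ws', M(q := c, r := d))"
proof -
  obtain us vs where ws: "ws = us @ q # vs" using assms(2) by (meson split_list)
  obtain d H1 H2 where d: "d \<in> D" "map M vs = H1 @ H2" "underivable Q (map M us @ [c] @ H1 @ [d] @ H2)"
    using rule[of "map M us" "map M vs"] assms(1) ws by (auto simp: consistent_def)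
  then obtain vs1 vs2 where vs: "vs = vs1 @ vs2" "H1 = map M vs1" "H2 = map M vs2"
    by (auto simp: map_eq_append_conv)
  have sorted: "sorted_wrt (<) ((us @ q # vs1) @ vs2)"
    using assms(1) ws vs by (simp add: consistent_def)
  then have "\<forall>x\<in>set (us @ q # vs1). \<forall>y\<in>set vs2. x < y" unfolding sorted_wrt_append by (elim conjE)
  from rat_between[OF this] obtain r
    where r: "\<forall>x\<in>set (us @ q # vs1). x < r" "\<forall>y\<in>set vs2. r < y" by blast
  let ?ws = "us @ q # vs1 @ r # vs2"
  have "q \<notin> set us" "q \<notin> set vs1" "q \<notin> set vs2" "r \<notin> set us" "r \<notin> set vs1" "r \<notin> set vs2" "r \<noteq> q"
    using sorted r by (auto simp: sorted_wrt_append)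
  then have r_ws: "r \<notin> set ws"
    and "map (M(q := c, r := d)) ?ws = map M us @ [c] @ H1 @ [d] @ H2"
    using vs ws by simp_all
  moreover have "sorted_wrt (<) ?ws"
    using sorted r by (auto simp: sorted_wrt_append)
  ultimately have "consistent Q (?ws, M(q := c, r := d))"
    using d(3) by (simp only: consistent_def fst_conv snd_conv)
  moreover have "set ?ws = insert r (set ws)" using ws vs by auto
  moreover have "q < r" using r by simp
  ultimately show ?thesis using d(1) r_ws by blast
qed

section \<open>Serving one occurrence by backward rule application\<close>

lemma step_update:
  assumes "consistent Q (ws, M)" "q \<in> set ws"
    and "\<And>G H. underivable Q (G @ [M q] @ H) \<Longrightarrow> \<exists>c\<in>C. underivable Q (G @ [c] @ H)"
    and "\<And>c. c \<in> C \<Longrightarrow> extends (ws, M) (ws, M(q := c)) \<and> fulfilled l a (ws, M(q := c)) q A"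
  shows "\<exists>s'. consistent Q s' \<and> extends (ws, M) s' \<and> fulfilled l a s' q A"
  using consistent_update[OF assms(1-3)] assms(4) by blast

lemma step_left:
  assumes cons: "consistent Q (ws, M)" and occ: "occurs True (ws, M) q X"
  shows "\<exists>s'. consistent Q s' \<and> extends (ws, M) s' \<and> fulfilled True a s' q X"
proof -
  have q: "q \<in> set ws" using occ by (simp add: occurs_def)
  obtain \<Gamma> where "fst (M q) = add_mset X \<Gamma>"
    using occ by (auto simp: occurs_def elim: mset_add)
  then obtain \<Delta> where M: "M q = (add_mset X \<Gamma>, \<Delta>)" by (cases "M q") auto
  note step = step_update[OF cons q, unfolded M]
  have same: "\<exists>s'. consistent Q s' \<and> extends (ws, M) s' \<and> fulfilled True a s' q X"
    if "fulfilled True a (ws, M) q X"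
    using that cons by (auto simp: extends_def)
  show ?thesis
  proof (cases X)
    case (Conj A B)
    show ?thesis
      by (rule step[of "{(add_mset A (add_mset B \<Gamma>), \<Delta>)}"])
        (use underivable_premise[OF conj_l[of _ A B \<Gamma> \<Delta>]] Conj q M in
          \<open>auto simp: extends_def occurs_def\<close>)
  next
    case (Disj A B)
    show ?thesis
      by (rule step[of "{(add_mset A \<Gamma>, \<Delta>), (add_mset B \<Gamma>, \<Delta>)}"])
        (use underivable_premise[OF disj_l[of _ A \<Gamma> \<Delta> _ B]] Disj q M in
          \<open>auto simp: extends_def occurs_def\<close>)
  next
    case (Imp A B)
    \<comment> \<open>The implication is first lifted to all later labels. Only then is
      \<open>imp_l\<close> applied at \<open>q\<close>, so the lifted copies survive even if the
      original disappears.\<close>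
    let ?M = "\<lambda>r. if q < r then apfst (add_mset X) (M r) else M r"
    let ?C = "{(add_mset B \<Gamma>, \<Delta>), (add_mset X \<Gamma>, add_mset A \<Delta>)}"
    obtain us vs where ws: "ws = us @ q # vs" using q by (meson split_list)
    have sorted: "\<forall>r\<in>set us. r < q" "\<forall>r\<in>set vs. q < r"
      using cons ws by (auto simp: consistent_def sorted_wrt_append)
    then have maps: "map ?M us = map M us" "map ?M vs = map (apfst (add_mset X)) (map M vs)" by auto
    have "map ?M ws = map ?M us @ [?M q] @ map ?M vs" by (simp add: ws)
    also have "\<dots> = map M us @ [(add_mset X \<Gamma>, \<Delta>)] @ map (apfst (add_mset X)) (map M vs)"
      by (simp only: maps M less_irrefl if_False)
    moreover have "map M ws = map M us @ [(add_mset X \<Gamma>, \<Delta>)] @ map M vs"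
      by (simp add: ws M)
    ultimately have "consistent Q (ws, ?M)"
      using cons underivable_lift[of Q "map M us" X \<Gamma> \<Delta> "map M vs"]
      by (simp only: consistent_def fst_conv snd_conv)
    moreover have "\<exists>c\<in>?C. underivable Q (G @ [c] @ H)" if "underivable Q (G @ [?M q] @ H)" for G H
      using underivable_premise[OF imp_l[of G B \<Gamma> \<Delta> H A]] that M Imp by auto
    ultimately obtain c where c: "c \<in> ?C" "consistent Q (ws, ?M(q := c))"
      using consistent_update[of Q ws ?M q ?C] q by blast
    have "extends (ws, M) (ws, ?M(q := c))" "fulfilled True a (ws, ?M(q := c)) q X"
      using c(1) q M Imp by (auto simp: extends_def occurs_def)
    with c(2) show ?thesis by blast
  next
    case (Forall x A)
    show ?thesis
      by (rule step[of "{(add_mset (subst a x A) (add_mset X \<Gamma>), \<Delta>)}"])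
        (use underivable_premise[OF forall_l[of _ a x A \<Gamma> \<Delta>]] Forall q M in
          \<open>auto simp: extends_def occurs_def\<close>)
  next
    case (Exists x A)
    let ?C = "range (\<lambda>b. (add_mset (subst b x A) \<Gamma>, \<Delta>))"
    have "\<exists>c\<in>?C. underivable Q (G @ [c] @ H)" if "underivable Q (G @ [(add_mset X \<Gamma>, \<Delta>)] @ H)" for G H
    proof -
      obtain b where "b \<notin> params_comps (G @ [(add_mset X \<Gamma>, \<Delta>)] @ H)" using fresh_param by blast
      then show ?thesis
        using underivable_premise[OF exists_l[of b G x A \<Gamma> \<Delta> H]] that Exists by auto
    qed
    then show ?thesis
      by (rule step) (use Exists q M in \<open>auto simp: extends_def occurs_def\<close>)
  qed (use same in auto)
qed

lemma step_right:
  assumes cons: "consistent Q (ws, M)" and occ: "occurs False (ws, M) q X"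
  shows "\<exists>s'. consistent Q s' \<and> extends (ws, M) s' \<and> fulfilled False a s' q X"
proof -
  have q: "q \<in> set ws" using occ by (simp add: occurs_def)
  obtain \<Delta> where "snd (M q) = add_mset X \<Delta>"
    using occ by (auto simp: occurs_def elim: mset_add)
  then obtain \<Gamma> where M: "M q = (\<Gamma>, add_mset X \<Delta>)" by (cases "M q") auto
  note step = step_update[OF cons q, unfolded M]
  note insert = consistent_insert[OF cons q, unfolded M]
  have same: "\<exists>s'. consistent Q s' \<and> extends (ws, M) s' \<and> fulfilled False a s' q X"
    if "fulfilled False a (ws, M) q X"
    using that cons by (auto simp: extends_def)
  show ?thesis
  proof (cases X)
    case (Conj A B)
    show ?thesis
      by (rule step[of "{(\<Gamma>, add_mset A \<Delta>), (\<Gamma>, add_mset B \<Delta>)}"])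
        (use underivable_premise[OF conj_r[of _ \<Gamma> A \<Delta> _ B]] Conj q M in
          \<open>auto simp: extends_def occurs_def\<close>)
  next
    case (Disj A B)
    show ?thesis
      by (rule step[of "{(\<Gamma>, add_mset A (add_mset B \<Delta>))}"])
        (use underivable_premise[OF disj_r[of _ \<Gamma> A B \<Delta>]] Disj q M in
          \<open>auto simp: extends_def occurs_def\<close>)
  next
    case (Imp A B)
    obtain ws' r where *: "set ws' = insert r (set ws)" "r \<notin> set ws" "q < r"
      and cons': "consistent Q (ws', M(q := (\<Gamma>, \<Delta>), r := ({#A#}, {#B#})))"
      using insert[of "{({#A#}, {#B#})}" "(\<Gamma>, \<Delta>)"] underivable_imp_r[of Q _ \<Gamma> A B \<Delta>] Imp by auto
    let ?s = "(ws', M(q := (\<Gamma>, \<Delta>), r := ({#A#}, {#B#})))"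
    have "extends (ws, M) ?s" "fulfilled False a ?s q X"
      using * q M Imp by (auto simp: extends_def occurs_def)
    with cons' show ?thesis by blast
  next
    case (Forall x A)
    have "\<exists>d\<in>range (\<lambda>b. ({#}, {#subst b x A#})). \<exists>H1 H2. H = H1 @ H2 \<and>
        underivable Q (G @ [(\<Gamma>, \<Delta>)] @ H1 @ [d] @ H2)"
      if "underivable Q (G @ [(\<Gamma>, add_mset X \<Delta>)] @ H)" for G H
      using underivable_forall_r[of Q G \<Gamma> x A \<Delta> H] that Forall by blast
    from insert[OF this] obtain ws' r b where *: "set ws' = insert r (set ws)" "r \<notin> set ws" "q < r"
      and cons': "consistent Q (ws', M(q := (\<Gamma>, \<Delta>), r := ({#}, {#subst b x A#})))"
      by blast
    let ?s = "(ws', M(q := (\<Gamma>, \<Delta>), r := ({#}, {#subst b x A#})))"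
    have "extends (ws, M) ?s" "fulfilled False a ?s q X"
      using * q M Forall by (auto simp: extends_def occurs_def)
    with cons' show ?thesis by blast
  next
    case (Exists x A)
    show ?thesis
      by (rule step[of "{(\<Gamma>, add_mset (subst a x A) (add_mset X \<Delta>))}"])
        (use underivable_premise[OF exists_r[of _ \<Gamma> a x A \<Delta>]] Exists q M in
          \<open>auto simp: extends_def occurs_def\<close>)
  qed (use same in auto)
qed

lemma step:
  assumes "consistent Q s"
  shows "\<exists>s'. consistent Q s' \<and> extends s s' \<and> (occurs l s q X \<longrightarrow> fulfilled l a s' q X)"
proof (cases "occurs l s q X")
  case True
  then show ?thesis using assms step_left step_right by (cases l; cases s; simp)
next
  case False
  then show ?thesis using assms by (intro exI[of _ s]) (simp add: extends_def)
qed

section \<open>The countermodel\<close>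

instance tm :: countable
  by countable_datatype

instance fm :: (countable) countable
  by countable_datatype

text \<open>The type of predicate symbols may be uncountable. Symbols in \<open>Q\<close> are
  therefore replaced by positions in a list, and formulae over natural numbers are
  countable.\<close>

lemma countable_language:
  assumes "finite Q"
  shows "\<exists>f :: nat \<Rightarrow> 'p fm. \<forall>A. set_fm A \<subseteq> Q \<longrightarrow> A \<in> range f"
proof -
  obtain xs where xs: "Q = set xs" using finite_list[OF assms] by blast
  let ?g = "\<lambda>i. xs ! i" and ?h = "\<lambda>p. SOME i. i < length xs \<and> xs ! i = p"
  have g_h: "?g (?h p) = p" if "p \<in> Q" for p
  proof -
    have "\<exists>i. i < length xs \<and> xs ! i = p" using that xs by (simp add: in_set_conv_nth)
    from someI_ex[OF this] show ?thesis by simp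
  qed
  have "A = map_fm ?g (from_nat (to_nat (map_fm ?h A)))" if "set_fm A \<subseteq> Q" for A
  proof -
    have "map_fm ?g (map_fm ?h A) = map_fm (\<lambda>p. ?g (?h p)) A" by (simp add: fm.map_comp comp_def)
    also have "\<dots> = map_fm id A" using that g_h by (intro fm.map_cong) auto
    finally show ?thesis by (simp add: fm.map_id)
  qed
  then show ?thesis by (intro exI[of _ "\<lambda>n. map_fm ?g (from_nat n)"]) blast
qed

text \<open>Every value recurs infinitely often: in the decoded pair the first entry is padding that
  makes the index large, and the second codes the value.\<close>

lemma fair_enumeration:
  "\<exists>t :: nat \<Rightarrow> 'a::countable. \<forall>x n. \<exists>m\<ge>n. t m = x"
proof -
  have "\<exists>m\<ge>n. from_nat (snd (prod_decode m)) = x" for x :: 'a and n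
    by (intro exI[of _ "prod_encode (n, to_nat x)"]) (simp add: le_prod_encode_1)
  then show ?thesis by (intro exI[of _ "\<lambda>m. from_nat (snd (prod_decode m))"]) blast
qed

lemma occurs_persists:
  assumes "\<And>n. extends (s n) (s (Suc n))" "n \<le> m" "occurs l (s n) q A"
  shows "occurs l (s m) q A \<or> (\<exists>k>n. decomposed l (s k) q A)"
  using assms(2)
proof (induction m rule: dec_induct)
  case (step m)
  then show ?case using assms(1)[of m] unfolding extends_def by (meson le_imp_less_Suc)
qed (use assms(3) in blast)

lemma consistent_occurs:
  assumes "consistent Q s" "occurs l s q A"
  shows "set_fm A \<subseteq> Q" "fvars A = {}"
proof -
  have "snd s q \<in> set (map (snd s) (fst s))" "A \<in># fst (snd s q) + snd (snd s q)"
    using assms(2) by (auto simp: occurs_def split: if_splits)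
  then show "set_fm A \<subseteq> Q" "fvars A = {}"
    using assms(1) unfolding consistent_def underivable_def is_lns_iff list_all_iff by blast+
qed

lemma not_underivable_initial: "LNIF [] C \<Longrightarrow> \<not> underivable Q C"
  using underivable_premise by fastforce

lemma consistent_not_Bot:
  assumes "consistent Q s"
  shows "\<not> occurs True s q Bot"
proof
  assume occ: "occurs True s q Bot"
  then obtain us vs where ws: "fst s = us @ q # vs" by (meson occurs_def split_list)
  obtain \<Gamma> where "fst (snd s q) = add_mset Bot \<Gamma>"
    using occ by (auto simp: occurs_def elim: mset_add)
  then obtain \<Delta> where "snd s q = (add_mset Bot \<Gamma>, \<Delta>)" by (cases "snd s q") auto
  then have "map (snd s) (fst s) = map (snd s) us @ [(add_mset Bot \<Gamma>, \<Delta>)] @ map (snd s) vs"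
    using ws by simp
  then show False
    using assms not_underivable_initial[OF bot_l] unfolding consistent_def by metis
qed

text \<open>Otherwise the state would be initial: by \<open>id1\<close> if the labels coincide, by
  \<open>id2\<close> if \<open>q\<close> comes before \<open>r\<close>.\<close>

lemma consistent_no_axiom:
  assumes cons: "consistent Q s"
    and occ: "occurs True s q (Atom p (map Par as))" "occurs False s r (Atom p (map Par as))"
  shows "r < q"
proof (rule ccontr)
  assume "\<not> r < q"
  let ?A = "Atom p (map Par as)"
  obtain \<Gamma> where \<Gamma>: "fst (snd s q) = add_mset ?A \<Gamma>"
    using occ by (auto simp: occurs_def elim: mset_add)
  obtain \<Delta> where \<Delta>: "snd (snd s r) = add_mset ?A \<Delta>"
    using occ by (auto simp: occurs_def elim: mset_add)
  have "q \<in> set (fst s)" "r \<in> set (fst s)" using occ by (auto simp: occurs_def)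
  obtain us vs where ws: "fst s = us @ q # vs"
    using \<open>q \<in> set (fst s)\<close> by (meson split_list)
  show False
  proof (cases "r = q")
    case True
    then have "map (snd s) (fst s) = map (snd s) us @ [(add_mset ?A \<Gamma>, add_mset ?A \<Delta>)] @ map (snd s) vs"
      using ws \<Gamma> \<Delta> by (cases "snd s q") auto
    then show False
      using cons not_underivable_initial[OF id1] unfolding consistent_def by metis
  next
    case False
    then have "r \<in> set vs"
      using \<open>\<not> r < q\<close> \<open>r \<in> set (fst s)\<close> ws cons by (auto simp: consistent_def sorted_wrt_append)
    then obtain vs1 vs2 where "vs = vs1 @ r # vs2" by (meson split_list)
    then have "map (snd s) (fst s) = map (snd s) us @ [(add_mset ?A \<Gamma>, snd (snd s q))] @
        map (snd s) vs1 @ [(fst (snd s r), add_mset ?A \<Delta>)] @ map (snd s) vs2"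
      using ws \<Gamma> \<Delta> by (cases "snd s q"; cases "snd s r") auto
    then show False
      using cons not_underivable_initial[OF id2] unfolding consistent_def by metis
  qed
qed

section \<open>Truth in the countermodel of a saturated sequence\<close>

lemma size_subst [simp]: "size (subst a x A) = size A"
  by (induction A) auto

lemma closed_atom:
  assumes "fvars (Atom p ts) = {}"
  shows "\<exists>as. ts = map Par as"
proof -
  have "\<exists>a. t = Par a" if "t \<in> set ts" for t
    using assms that by (cases t) auto
  then show ?thesis by (induction ts) (auto, metis list.simps(9))
qed

locale saturated_sequence =
  fixes s :: "nat \<Rightarrow> 'p state" and Q :: "'p set"
  assumes consistent: "consistent Q (s n)"
    and extends: "extends (s n) (s (Suc n))"
    and fair: "occurs l (s n) q A \<Longrightarrow> \<exists>m\<ge>n. decomposed l (s m) q A \<or> fulfilled l a (s m) q A"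
begin

definition worlds :: "rat set" where
  "worlds = (\<Union>n. set (fst (s n)))"

text \<open>Closing upwards along \<open>q \<le> r\<close> makes the valuation monotone by
  construction, although the search does not lift atoms.\<close>

definition true_atom :: "rat \<Rightarrow> 'p \<Rightarrow> nat list \<Rightarrow> bool" where
  "true_atom r p as \<longleftrightarrow> (\<exists>n q. q \<le> r \<and> occurs True (s n) q (Atom p (map Par as)))"

text \<open>Each parameter denotes itself, so every domain element is named by a parameter.\<close>

abbreviation forces :: "(nat \<Rightarrow> nat) \<Rightarrow> rat \<Rightarrow> 'p fm \<Rightarrow> bool" where
  "forces \<equiv> sat worlds true_atom (\<lambda>a. a)"

lemma mono_true_atom: "mono true_atom"
  by (rule monoI) (auto simp: true_atom_def le_fun_def intro: order_trans)

lemma labels_mono: "n \<le> m \<Longrightarrow> set (fst (s n)) \<subseteq> set (fst (s m))"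
  by (induction m rule: dec_induct) (use extends in \<open>auto simp: extends_def\<close>)

lemma occurs_world: "occurs l (s n) q A \<Longrightarrow> q \<in> worlds"
  by (auto simp: occurs_def worlds_def)

text \<open>Induction on size rather than structure, because the instances
  \<open>subst a x A\<close> have to be covered. Both sides go together, since an implication on the
  left may put its antecedent on the right.\<close>

lemma truth:
  "(occurs True (s n) q A \<longrightarrow> forces e q A) \<and> (occurs False (s n) q A \<longrightarrow> \<not> forces e q A)"
proof (induction A arbitrary: n q e rule: measure_induct_rule[of size])
  case (less X)
  have T: "forces e q A" if "occurs True (s n) q A" "size A < size X" for A n q e
    using less.IH that by blast
  have F: "\<not> forces e q A" if "occurs False (s n) q A" "size A < size X" for A n q e
    using less.IH that by blast
  have fair_X: "\<exists>m. fulfilled l a (s m) q X \<or> decomposed l (s m) q X" if "occurs l (s n) q X" for l a n q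
    using fair[OF that] by blast
  note mono = sat_mono[OF mono_true_atom]
  have closed: "fvars X = {}" if "occurs l (s n) q X" for l
    using consistent_occurs[OF consistent that] by blast
  show ?case
  proof (cases X)
    case (Atom p ts)
    show ?thesis
    proof (intro conjI impI notI)
      assume occ: "occurs True (s n) q X"
      then obtain as where "ts = map Par as" using closed_atom[of p ts] closed[OF occ] Atom by auto
      then show "forces e q X" using occ Atom by (auto simp: true_atom_def comp_def)
    next
      assume occ: "occurs False (s n) q X" and "forces e q X"
      moreover obtain as where ts: "ts = map Par as" using closed_atom[of p ts] closed[OF occ] Atom by auto
      ultimately obtain m r where "r \<le> q" "occurs True (s m) r X"
        using Atom by (auto simp: true_atom_def comp_def)
      \<comment> \<open>Atoms are never decomposed, so both occurrences persist to a common
        stage.\<close>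
      then have "occurs True (s (max m n)) r X" "occurs False (s (max m n)) q X"
        using occ occurs_persists[of s, OF extends, of m "max m n" True r X]
          occurs_persists[of s, OF extends, of n "max m n" False q X] Atom
        by auto
      then show False
        using consistent_no_axiom[OF consistent] \<open>r \<le> q\<close> Atom ts by (metis not_le)
    qed
  next
    case Bot
    then show ?thesis using consistent_not_Bot[OF consistent] by simp
  next
    case (Conj A B)
    show ?thesis
    proof (intro conjI impI)
      assume occ: "occurs True (s n) q X"
      obtain m where "occurs True (s m) q A" "occurs True (s m) q B"
        using fair_X[OF occ] Conj by auto
      then show "forces e q X" using T[of m q A e] T[of m q B e] Conj by simp
    next
      assume occ: "occurs False (s n) q X"
      obtain m where "occurs False (s m) q A \<or> occurs False (s m) q B"
        using fair_X[OF occ] Conj by auto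
      then show "\<not> forces e q X" using F[of m q A e] F[of m q B e] Conj by auto
    qed
  next
    case (Disj A B)
    show ?thesis
    proof (intro conjI impI)
      assume occ: "occurs True (s n) q X"
      obtain m where "occurs True (s m) q A \<or> occurs True (s m) q B"
        using fair_X[OF occ] Disj by auto
      then show "forces e q X" using T[of m q A e] T[of m q B e] Disj by auto
    next
      assume occ: "occurs False (s n) q X"
      obtain m where "occurs False (s m) q A" "occurs False (s m) q B"
        using fair_X[OF occ] Disj by auto
      then show "\<not> forces e q X" using F[of m q A e] F[of m q B e] Disj by simp
    qed
  next
    case (Imp A B)
    have local: "forces e r B" if occ: "occurs True (s k) r X" and A: "forces e r A" for k r
    proof -
      obtain m where "occurs True (s m) r B \<or> occurs False (s m) r A"
        using fair_X[OF occ] Imp by auto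
      then show ?thesis using T[of m r B] F[of m r A] A Imp by auto
    qed
    show ?thesis
    proof (intro conjI impI notI)
      assume occ: "occurs True (s n) q X"
      have "forces e r B" if r: "r \<in> worlds" "q \<le> r" and A: "forces e r A" for r
      \<comment> \<open>If \<open>B\<close> ever appears on the left at \<open>q\<close>, it is
        forced at \<open>r\<close> by persistence. If not, the implication never leaves
        \<open>q\<close>; it is still there once the label \<open>r\<close> exists, and fairness
        then lifts it to \<open>r\<close>.\<close>
      proof (cases "\<exists>m. occurs True (s m) q B")
        case True
        then show ?thesis using T[of _ q B e] mono[OF r(2)] Imp by auto
      next
        case False
        then have undec: "\<not> decomposed True (s m) q X" for m using Imp by simp
        obtain k where "r \<in> set (fst (s k))" using r by (auto simp: worlds_def)
        then have k: "r \<in> set (fst (s m))" if "max k n \<le> m" for m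
          using labels_mono[of k m] that by auto
        have "occurs True (s (max k n)) q X"
          using occurs_persists[of s, OF extends _ occ, of "max k n"] undec by simp
        from fair[OF this] undec obtain m where "max k n \<le> m" "fulfilled True 0 (s m) q X" by blast
        then have "occurs True (s m) r X" if "q < r" using that k Imp by auto
        then have "\<exists>m. occurs True (s m) r X" using occ r(2) by (cases "q = r") auto
        then show ?thesis using local A by blast
      qed
      then show "forces e q X" using Imp by simp
    next
      assume occ: "occurs False (s n) q X" and X: "forces e q X"
      obtain m r where "q < r" "occurs True (s m) r A" "occurs False (s m) r B"
        using fair_X[OF occ] Imp by auto
      then show False
        using X T[of m r A e] F[of m r B e] occurs_world[of True m r A] Imp by auto
    qed
  next
    case (Forall x A)
    show ?thesis
    proof (intro conjI impI notI)
      assume occ: "occurs True (s n) q X"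
      have "forces (e(x := d)) q A" for d
      proof -
        obtain m where "occurs True (s m) q (subst d x A)"
          using fair_X[OF occ, of d] Forall by auto
        then show ?thesis using T[of m q "subst d x A" e] Forall by (simp add: sat_subst)
      qed
      then show "forces e q X" using Forall by simp
    next
      assume occ: "occurs False (s n) q X" and X: "forces e q X"
      obtain m r b where "q < r" "occurs False (s m) r (subst b x A)"
        using fair_X[OF occ] Forall by auto
      \<comment> \<open>The witness sits at a later label, so \<open>X\<close> is first carried from
        \<open>q\<close> to \<open>r\<close> by persistence.\<close>
      then show False
        using mono[OF _ X, of r] F[of m r "subst b x A" e] Forall by (auto simp: sat_subst)
    qed
  next
    case (Exists x A)
    show ?thesis
    proof (intro conjI impI notI)
      assume occ: "occurs True (s n) q X"
      obtain m b where "occurs True (s m) q (subst b x A)"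
        using fair_X[OF occ] Exists by auto
      then show "forces e q X" using T[of m q "subst b x A" e] Exists by (auto simp: sat_subst)
    next
      assume occ: "occurs False (s n) q X" and "forces e q X"
      then obtain d where d: "forces (e(x := d)) q A" using Exists by auto
      obtain m where "occurs False (s m) q (subst d x A)"
        using fair_X[OF occ, of d] Exists by auto
      then show False using d F[of m q "subst d x A" e] Exists by (simp add: sat_subst)
    qed
  qed
qed

lemma refutable_state: "refutable worlds true_atom e (map (snd (s n)) (fst (s n)))"
proof -
  have "sorted (fst (s n))"
    using consistent[of n] by (simp add: consistent_def strict_sorted_iff)
  moreover have "refutes worlds true_atom (\<lambda>a. a) e q (snd (s n) q)" if "q \<in> set (fst (s n))" for q
    using truth[of n q _ e] that by (auto simp: refutes_def occurs_def)
  then have "list_all2 (refutes worlds true_atom (\<lambda>a. a) e) (fst (s n)) (map (snd (s n)) (fst (s n)))"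
    by (simp add: list_all2_map2 list_all2_same)
  moreover have "set (fst (s n)) \<subseteq> worlds" by (auto simp: worlds_def)
  ultimately show ?thesis unfolding refutable_def by blast
qed

end

section \<open>Construction of the saturated sequence, completeness and cut elimination\<close>

text \<open>Stage \<open>n\<close> serves the task \<open>t n\<close>, made of a side, a parameter,
  a label and a formula index. Every task recurs beyond any stage, so none is missed.\<close>

lemma saturated_sequence_exists:
  assumes "consistent Q s0" "finite Q"
  shows "\<exists>s. s 0 = s0 \<and> saturated_sequence s Q"
proof -
  obtain f :: "nat \<Rightarrow> 'a fm" where f: "\<forall>A. set_fm A \<subseteq> Q \<longrightarrow> A \<in> range f"
    using countable_language[OF assms(2)] by blast
  obtain t :: "nat \<Rightarrow> bool \<times> nat \<times> rat \<times> nat" where t: "\<forall>x n. \<exists>m\<ge>n. t m = x"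
    using fair_enumeration by blast
  let ?serves = "\<lambda>s s' (l, a, q, i). occurs l s q (f i) \<longrightarrow> fulfilled l a s' q (f i)"
  have next_state: "\<exists>s'. consistent Q s' \<and> extends s s' \<and> ?serves s s' x" if "consistent Q s" for s x
    using step[OF that] by (cases x) auto
  \<comment> \<open>The conjunct about \<open>n = 0\<close> pins the initial state, which dependent
    choice would otherwise leave open.\<close>
  have "\<exists>s. \<forall>n. (consistent Q (s n) \<and> (n = 0 \<longrightarrow> s n = s0)) \<and>
      (extends (s n) (s (Suc n)) \<and> ?serves (s n) (s (Suc n)) (t n))"
  proof (rule dependent_nat_choice)
    show "\<exists>s. consistent Q s \<and> (0 = 0 \<longrightarrow> s = s0)" using assms(1) by blast
  next
    fix s and n :: nat
    assume "consistent Q s \<and> (n = 0 \<longrightarrow> s = s0)"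
    then show "\<exists>s'. (consistent Q s' \<and> (Suc n = 0 \<longrightarrow> s' = s0)) \<and> extends s s' \<and> ?serves s s' (t n)"
      using next_state[of s "t n"] by simp
  qed
  then obtain s where "\<forall>n. (consistent Q (s n) \<and> (n = 0 \<longrightarrow> s n = s0)) \<and>
      (extends (s n) (s (Suc n)) \<and> ?serves (s n) (s (Suc n)) (t n))" ..
  then have s: "s 0 = s0" "\<And>n. consistent Q (s n)"
      "\<And>n. extends (s n) (s (Suc n)) \<and> ?serves (s n) (s (Suc n)) (t n)"
    by simp_all
  have "\<exists>m\<ge>n. decomposed l (s m) q A \<or> fulfilled l a (s m) q A" if occ: "occurs l (s n) q A" for l n q A a
  proof -
    obtain i where i: "A = f i" using f consistent_occurs(1)[OF s(2) occ] by blast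
    obtain m where m: "m \<ge> n" "t m = (l, a, q, i)" using t by blast
    show ?thesis
    \<comment> \<open>Stage \<open>m\<close> is the turn of this task. An occurrence that is still
      present is served at \<open>Suc m\<close>; one that has vanished was decomposed after
      \<open>n\<close>.\<close>
    proof (cases "occurs l (s m) q A")
      case True
      then have "fulfilled l a (s (Suc m)) q A" using s(3)[of m] m i by simp
      then show ?thesis using m by (meson le_SucI)
    next
      case False
      then show ?thesis using occurs_persists[of s, OF _ m(1) occ] s(3) less_imp_le by blast
    qed
  qed
  then have "saturated_sequence s Q" using s by unfold_locales auto
  then show ?thesis using s(1) by blast
qed

text \<open>Rational worlds and natural numbers as domain suffice, since these are the types of
  labels and parameters.\<close>

lemma completeness:
  assumes "is_lns S"
    and "\<And>(W :: rat set) (V :: rat \<Rightarrow> 'p \<Rightarrow> nat list \<Rightarrow> bool) e. mono V \<Longrightarrow> \<not> refutable W V e S"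
  shows "derivable LNIF S"
proof (rule ccontr)
  assume underiv: "\<not> derivable LNIF S"
  define Q where "Q = (\<Union>c\<in>set S. \<Union>A\<in>set_mset (fst c + snd c). set_fm A)"
  have "finite (set_fm A)" for A :: "'p fm" by (induction A) auto
  then have "finite Q" by (auto simp: Q_def)
  \<comment> \<open>The components get the labels 0, 1, 2 and so on; the floor turns a label back
    into a list index.\<close>
  define M where "M = (\<lambda>q::rat. S ! nat \<lfloor>q\<rfloor>)"
  define ws where "ws = map (of_nat :: nat \<Rightarrow> rat) [0..<length S]"
  have S: "map M ws = S"
    by (simp add: M_def ws_def comp_def map_nth)
  have "underivable Q S"
    using assms(1) underiv by (force simp: underivable_def list_all_iff Q_def)
  then have "consistent Q (ws, M)"
    using S by (simp add: consistent_def) (simp add: ws_def sorted_wrt_map sorted_wrt_upt)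
  then obtain s where s: "s 0 = (ws, M)" "saturated_sequence s Q"
    using saturated_sequence_exists \<open>finite Q\<close> by blast
  then interpret saturated_sequence s Q by simp
  show False
    \<comment> \<open>Stage 0 is \<open>S\<close> itself, so the countermodel of the sequence
      refutes \<open>S\<close>.\<close>
    using refutable_state[of undefined 0] assms(2)[OF mono_true_atom] s(1) S by simp
qed

theorem theorem4:
  fixes S :: "'p comps"
  assumes "derivable (\<lambda>Ps C. LNIF Ps C \<or> cut Ps C) S"
  shows "derivable LNIF S"
proof (rule completeness)
  show "is_lns S" using assms by cases
qed (use derivable_sound assms in blast)

end
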